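(* Let $n,r,s \in \mathbb{N}$. Then $m(n,r,s,1) \geqslant \left(1 - e^{-s^2/3r}\right) n$.
   Context: An $r$-colouring of the complete graph $K_n$ ($n \geqslant 2$) is any function $f: E(K_n) \to [r] = \{1,\dots,r\}$. For a subgraph $H \subseteq K_n$, $c_f(H) = |f(E(H))|$ is the number of distinct colours on edges of $H$. A graph on at least $k+1$ vertices is $k$-connected if deleting any at most $k-1$ vertices leaves a connected graph. $M(f,n,r,s,k)$ is the maximum number of vertices of a $k$-connected subgraph $H \subseteq K_n$ with $c_f(H) \leqslant s$ (taken to be $0$ if no such subgraph exists), and $m(n,r,s,k) = \min_f M(f,n,r,s,k)$, the minimum over all $r$-colourings $f$ of $E(K_n)$. *)

theory Defs
  imports Complex_Main "HOL-Library.FuncSet" "HOL-Library.Ramsey"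
begin

text \<open>A simple graph is given by a vertex set \<open>V\<close> and an edge set \<open>E\<close> consisting of
  two-element subsets of \<open>V\<close>, so the edge set of the complete graph on \<open>V\<close> is
  \<open>nsets V 2\<close>, written \<open>[V]\<^bsup>2\<^esup>\<close>.\<close>

definition connected_graph :: "'a set \<Rightarrow> 'a set set \<Rightarrow> bool" where
  "connected_graph V E \<longleftrightarrow>
     V \<noteq> {} \<and> (\<forall>u\<in>V. \<forall>v\<in>V. (u, v) \<in> {(x, y). {x, y} \<in> E}\<^sup>*)"

definition delete_vertices_edges :: "'a set set \<Rightarrow> 'a set \<Rightarrow> 'a set set" where
  "delete_vertices_edges E X = {e \<in> E. e \<inter> X = {}}"

text \<open>``At most \<open>k - 1\<close> vertices'' is written \<open>card X < k\<close> to avoid truncated subtraction.\<close>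

definition k_connected :: "nat \<Rightarrow> 'a set \<Rightarrow> 'a set set \<Rightarrow> bool" where
  "k_connected k V E \<longleftrightarrow> finite V \<and> card V \<ge> k + 1 \<and>
     (\<forall>X. X \<subseteq> V \<and> card X < k \<longrightarrow> connected_graph (V - X) (delete_vertices_edges E X))"

definition K_edges :: "nat \<Rightarrow> nat set set" where
  "K_edges n = [{1..n}]\<^bsup>2\<^esup>"

definition colourings :: "nat \<Rightarrow> nat \<Rightarrow> (nat set \<Rightarrow> nat) set" where
  "colourings n r = K_edges n \<rightarrow>\<^sub>E {1..r}"

definition subgraph_of_K :: "nat \<Rightarrow> nat set \<Rightarrow> nat set set \<Rightarrow> bool" where
  "subgraph_of_K n V E \<longleftrightarrow> V \<subseteq> {1..n} \<and> E \<subseteq> [V]\<^bsup>2\<^esup>"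

definition num_colours :: "(nat set \<Rightarrow> nat) \<Rightarrow> nat set set \<Rightarrow> nat" where
  "num_colours f E = card (f ` E)"

text \<open>\<open>max_order f n s k\<close> is \<open>M(f,n,r,s,k)\<close>; the number \<open>r\<close> of available colours enters only
  through the codomain of \<open>f\<close>, so it is not an argument. Inserting \<open>0\<close> gives the convention
  for the case that no suitable subgraph exists.\<close>

definition max_order :: "(nat set \<Rightarrow> nat) \<Rightarrow> nat \<Rightarrow> nat \<Rightarrow> nat \<Rightarrow> nat" where
  "max_order f n s k = Max (insert 0
     {card V | V E. subgraph_of_K n V E \<and> k_connected k V E \<and> num_colours f E \<le> s})"

text \<open>The set of colourings is finite, and nonempty for \<open>r \<ge> 1\<close>, so the minimum is genuine.\<close>

definition min_max_order :: "nat \<Rightarrow> nat \<Rightarrow> nat \<Rightarrow> nat \<Rightarrow> nat" where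
  "min_max_order n r s k = Min ((\<lambda>f. max_order f n s k) ` colourings n r)"

end

(* Let A be a largest vertex set that is connected using at most j colours. A vertex w outside A
   sends more than j colours to A, since otherwise the star from w to A would be a larger
   such set. Averaging over the r colours, some colour joins at least a fraction (j + 1) / r of the
   outer vertices to A. Iterating, at most n * exp (- s * (s + 1) / (2 * r)) vertices
   are missed with s colours, and s * (s + 1) / 2 \<ge> s^2 / 3. *)
theory Submission
  imports Defs
begin

text \<open>The edge set is existentially quantified, so that maximality can be stated for vertex
  sets alone. There is no lower bound on the order: a singleton qualifies with no colours, which
  starts the induction at \<open>j = 0\<close>.\<close>

definition colour_connected :: "('a set \<Rightarrow> 'c) \<Rightarrow> nat \<Rightarrow> 'a set \<Rightarrow> bool" where
  "colour_connected f j A \<longleftrightarrow> (\<exists>E \<subseteq> [A]\<^bsup>2\<^esup>. connected_graph A E \<and> card (f ` E) \<le> j)"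

lemma connected_graph_singleton: "connected_graph {w} E"
  by (simp add: connected_graph_def)

text \<open>Everything reaches one fixed root in \<open>A\<close>: vertices of \<open>A\<close> by
  connectedness, the others after a single edge of \<open>F\<close>. Reachability is symmetric, so
  any two vertices are joined through the root.\<close>

lemma connected_graph_extend:
  assumes A: "connected_graph A E" and B: "\<And>w. w \<in> B \<Longrightarrow> \<exists>a\<in>A. {w, a} \<in> F"
  shows "connected_graph (A \<union> B) (E \<union> F)"
proof -
  let ?R = "{(x, y). {x, y} \<in> E \<union> F}"
  have sym: "(v, u) \<in> ?R\<^sup>*" if "(u, v) \<in> ?R\<^sup>*" for u v
  proof -
    have "sym ?R" by (auto simp: sym_def insert_commute)
    then show ?thesis using that by (meson sym_rtrancl symD)
  qed
  obtain a where a: "a \<in> A" using A by (auto simp: connected_graph_def)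
  have A_root: "(u, a) \<in> ?R\<^sup>*" if "u \<in> A" for u
  proof -
    have "(u, a) \<in> {(x, y). {x, y} \<in> E}\<^sup>*" using A a that by (auto simp: connected_graph_def)
    then show ?thesis by (rule rtrancl_mono[THEN subsetD, rotated]) auto
  qed
  have root: "(u, a) \<in> ?R\<^sup>*" if "u \<in> A \<union> B" for u
  proof (cases "u \<in> A")
    case False
    then obtain b where b: "b \<in> A" "{u, b} \<in> F" using B \<open>u \<in> A \<union> B\<close> by blast
    then have "(u, b) \<in> ?R" by simp
    then show ?thesis using A_root[OF b(1)] by (rule converse_rtrancl_into_rtrancl)
  qed (rule A_root)
  have "(u, v) \<in> ?R\<^sup>*" if "u \<in> A \<union> B" "v \<in> A \<union> B" for u v
    using root[OF that(1)] sym[OF root[OF that(2)]] by (rule rtrancl_trans)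
  then show ?thesis using a by (auto simp: connected_graph_def)
qed

lemma colour_connected_singleton: "colour_connected f j {w}"
  unfolding colour_connected_def
  by (rule exI[of _ "{}"]) (simp add: connected_graph_singleton)

text \<open>The star at \<open>w\<close> alone spans the new set; edges inside \<open>A\<close> are
  discarded, so only the colours between \<open>w\<close> and \<open>A\<close> count. Applied to a
  largest \<open>A\<close>, this forces every outer vertex to see more than \<open>j\<close>
  colours.\<close>

lemma colour_connected_star:
  assumes "finite A" "w \<notin> A" "card ((\<lambda>a. f {w, a}) ` A) \<le> j"
  shows "colour_connected f j (insert w A)"
proof -
  let ?F = "(\<lambda>a. {w, a}) ` A"
  have "connected_graph ({w} \<union> A) ({} \<union> ?F)"
    by (rule connected_graph_extend[OF connected_graph_singleton]) (auto simp: insert_commute)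
  moreover have "?F \<subseteq> [insert w A]\<^bsup>2\<^esup>" using assms(2) by auto
  ultimately show ?thesis using assms(3)
    unfolding colour_connected_def by (intro exI[of _ ?F]) (simp add: image_image)
qed

text \<open>All edges of colour \<open>c\<close> between \<open>B\<close> and \<open>A\<close> are
  added to the old edge set, so at most the one colour \<open>c\<close> is new.\<close>

lemma colour_connected_add_colour:
  assumes A: "colour_connected f j A" and fin: "finite A"
    and B: "\<And>w. w \<in> B \<Longrightarrow> w \<notin> A \<and> (\<exists>a\<in>A. f {w, a} = c)"
  shows "colour_connected f (Suc j) (A \<union> B)"
proof -
  obtain E where E: "E \<subseteq> [A]\<^bsup>2\<^esup>" "connected_graph A E" "card (f ` E) \<le> j"
    using A by (auto simp: colour_connected_def)
  let ?F = "{{w, a} | w a. w \<in> B \<and> a \<in> A \<and> f {w, a} = c}"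
  have "connected_graph (A \<union> B) (E \<union> ?F)"
    by (rule connected_graph_extend[OF E(2)]) (use B in blast)
  moreover have "E \<union> ?F \<subseteq> [A \<union> B]\<^bsup>2\<^esup>"
  proof (rule Un_least)
    show "E \<subseteq> [A \<union> B]\<^bsup>2\<^esup>" using E(1) nsets_mono[of A "A \<union> B" 2] by blast
    show "?F \<subseteq> [A \<union> B]\<^bsup>2\<^esup>" using B by auto
  qed
  moreover have "card (f ` (E \<union> ?F)) \<le> Suc j"
  proof -
    have "finite E" using E(1) fin by (meson finite_imp_finite_nsets finite_subset)
    then have "card (f ` (E \<union> ?F)) \<le> card (insert c (f ` E))"
      by (intro card_mono) auto
    also have "\<dots> \<le> Suc j" using E(3) \<open>finite E\<close> by (simp add: card_insert_if)
    finally show ?thesis .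
  qed
  ultimately show ?thesis
    unfolding colour_connected_def by (intro exI[of _ "E \<union> ?F"] conjI)
qed

lemma max_colour_connected_exists:
  assumes "finite V" "A \<subseteq> V" "colour_connected f j A"
  obtains M where "M \<subseteq> V" "colour_connected f j M"
    "\<And>B. B \<subseteq> V \<Longrightarrow> colour_connected f j B \<Longrightarrow> card B \<le> card M"
proof -
  let ?P = "\<lambda>B. B \<subseteq> V \<and> colour_connected f j B"
  have "\<exists>M. ?P M \<and> (\<forall>B. ?P B \<longrightarrow> card B \<le> card M)"
    by (rule ex_has_greatest_nat[of ?P A card "Suc (card V)"])
      (use assms in \<open>auto simp: card_mono less_Suc_eq_le\<close>)
  then show thesis using that by blast
qed

text \<open>Double counting of the pairs \<open>(w, c)\<close> with \<open>c \<in> G w\<close>,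
  followed by averaging over \<open>C\<close>. The product form keeps the argument in the natural
  numbers.\<close>

lemma exists_popular_colour:
  assumes fin: "finite W" "finite C" and C: "C \<noteq> {}"
    and G: "\<And>w. w \<in> W \<Longrightarrow> G w \<subseteq> C" "\<And>w. w \<in> W \<Longrightarrow> d \<le> card (G w)"
  obtains c where "c \<in> C" "d * card W \<le> card C * card {w \<in> W. c \<in> G w}"
proof -
  have "d * card W \<le> (\<Sum>w\<in>W. card (G w))"
    using sum_mono[of W "\<lambda>_. d" "\<lambda>w. card (G w)"] G(2) by (simp add: mult.commute)
  also have "\<dots> = (\<Sum>w\<in>W. card {c \<in> C. c \<in> G w})"
    using G(1) by (intro sum.cong refl arg_cong[of _ _ card]) auto
  also have "\<dots> = (\<Sum>c\<in>C. card {w \<in> W. c \<in> G w})"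
    using sum_multicount_gen[of W C "\<lambda>w c. c \<in> G w" "\<lambda>c. card {w \<in> W. c \<in> G w}"] fin by simp
  finally have le: "d * card W \<le> (\<Sum>c\<in>C. card {w \<in> W. c \<in> G w})" .
  show thesis
  proof (rule ccontr)
    assume "\<not> thesis"
    \<comment> \<open>If every colour were below average, summing over the nonempty \<open>C\<close>
      would contradict the double count.\<close>
    then have "card C * card {w \<in> W. c \<in> G w} < d * card W" if "c \<in> C" for c
      using that \<open>\<And>c. c \<in> C \<Longrightarrow> d * card W \<le> card C * card {w \<in> W. c \<in> G w} \<Longrightarrow> thesis\<close>
      by (meson not_le)
    then have "(\<Sum>c\<in>C. card C * card {w \<in> W. c \<in> G w}) < (\<Sum>c\<in>C. d * card W)"
      using fin C by (intro sum_strict_mono) auto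
    then have "card C * (\<Sum>c\<in>C. card {w \<in> W. c \<in> G w}) < card C * (d * card W)"
      by (simp add: sum_distrib_left)
    then show False using le by (simp add: mult_less_cancel1)
  qed
qed

text \<open>\<open>B\<close> adds to \<open>A\<close> all outer vertices joined to it by a popular
  colour. Maximality of \<open>A\<close> supplies the \<open>Suc j\<close> colours per outer vertex;
  \<open>B\<close> itself is not claimed to be maximal.\<close>

lemma colour_connected_step:
  assumes fin: "finite V" "finite C" and f: "f \<in> [V]\<^bsup>2\<^esup> \<rightarrow> C" and C: "C \<noteq> {}"
    and A: "A \<subseteq> V" "colour_connected f j A"
    and max: "\<And>B. B \<subseteq> V \<Longrightarrow> colour_connected f j B \<Longrightarrow> card B \<le> card A"
  obtains B where "B \<subseteq> V" "colour_connected f (Suc j) B"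
    "real (card (V - B)) \<le> (1 - real (Suc j) / card C) * real (card (V - A))"
proof -
  have finA: "finite A" using A(1) fin(1) by (rule finite_subset)
  let ?G = "\<lambda>w. (\<lambda>a. f {w, a}) ` A"
  have many: "Suc j \<le> card (?G w)" if w: "w \<in> V - A" for w
  proof (rule ccontr)
    assume "\<not> Suc j \<le> card (?G w)"
    then have "colour_connected f j (insert w A)"
      using w finA by (intro colour_connected_star) auto
    then have "card (insert w A) \<le> card A" using w A(1) by (intro max) auto
    then show False using w finA by simp
  qed
  have GC: "?G w \<subseteq> C" if "w \<in> V - A" for w
  proof
    fix c assume "c \<in> ?G w"
    then obtain a where "a \<in> A" "c = f {w, a}" by blast
    moreover from this have "{w, a} \<in> [V]\<^bsup>2\<^esup>" using that A(1) by auto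
    ultimately show "c \<in> C" using f by blast
  qed
  obtain c where c: "c \<in> C" "Suc j * card (V - A) \<le> card C * card {w \<in> V - A. c \<in> ?G w}"
    by (rule exists_popular_colour[of "V - A" C ?G "Suc j",
          OF finite_Diff[OF fin(1)] fin(2) C GC many])
  define N where "N = {w \<in> V - A. c \<in> ?G w}"
  have N: "N \<subseteq> V - A" by (auto simp: N_def)
  have "card N \<le> card (V - A)" using N fin(1) by (simp add: card_mono)
  moreover have "card (V - A - N) = card (V - A) - card N"
    using N fin(1) by (meson card_Diff_subset finite_Diff finite_subset)
  moreover have "V - (A \<union> N) = V - A - N" by blast
  ultimately have eq: "real (card (V - (A \<union> N))) = real (card (V - A)) - real (card N)"
    by (simp add: of_nat_diff)
  show thesis
  proof (rule that)
    show "A \<union> N \<subseteq> V" using A(1) N by blast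
    have "w \<notin> A \<and> (\<exists>a\<in>A. f {w, a} = c)" if "w \<in> N" for w
      using that unfolding N_def by blast
    then show "colour_connected f (Suc j) (A \<union> N)"
      by (rule colour_connected_add_colour[OF A(2) finA])
    have pos: "real (card C) > 0" using fin C by (simp add: card_gt_0_iff)
    have "real (Suc j) * real (card (V - A)) \<le> real (card C) * real (card N)"
      using of_nat_mono[OF c(2), where ?'a = real] unfolding N_def by (simp only: of_nat_mult)
    then have "real (Suc j) / card C * card (V - A) \<le> card N"
      using pos by (simp add: pos_divide_le_eq mult.commute)
    then show "real (card (V - (A \<union> N))) \<le> (1 - real (Suc j) / card C) * real (card (V - A))"
      unfolding eq by (simp add: algebra_simps)
  qed
qed

text \<open>Step \<open>i\<close> contributes a factor of at most \<open>exp (- i / card C)\<close>,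
  and \<open>1 + ... + j = j * (j + 1) / 2\<close> gives the exponent.\<close>

lemma colour_connected_large:
  assumes fin: "finite V" "finite C" and f: "f \<in> [V]\<^bsup>2\<^esup> \<rightarrow> C" and ne: "V \<noteq> {}" "C \<noteq> {}"
  shows "\<exists>A\<subseteq>V. colour_connected f j A \<and>
    real (card (V - A)) \<le> exp (- (real j * (real j + 1) / (2 * card C))) * card V"
proof (induction j)
  case 0
  obtain v where v: "v \<in> V" using ne(1) by blast
  have "card (V - {v}) \<le> card V" using fin(1) by (intro card_mono) auto
  then show ?case using v colour_connected_singleton by (intro exI[of _ "{v}"]) auto
next
  case (Suc j)
  then obtain A where A: "A \<subseteq> V" "colour_connected f j A"
    "real (card (V - A)) \<le> exp (- (real j * (real j + 1) / (2 * card C))) * card V" by blast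
  obtain M where M: "M \<subseteq> V" "colour_connected f j M"
    "\<And>B. B \<subseteq> V \<Longrightarrow> colour_connected f j B \<Longrightarrow> card B \<le> card M"
    using max_colour_connected_exists[OF fin(1) A(1,2)] by blast
  \<comment> \<open>The set from the induction hypothesis may fail to be largest; passing to a
    largest \<open>M\<close> keeps the bound and permits the next step.\<close>
  have "card (V - M) \<le> card (V - A)"
    using M(3)[OF A(1,2)] fin(1) M(1) A(1)
    by (simp add: card_Diff_subset finite_subset diff_le_mono2)
  then have VM: "real (card (V - M)) \<le> exp (- (real j * (real j + 1) / (2 * card C))) * card V"
    using A(3) by linarith
  obtain B where B: "B \<subseteq> V" "colour_connected f (Suc j) B"
    "real (card (V - B)) \<le> (1 - real (Suc j) / card C) * real (card (V - M))"
    using colour_connected_step[OF fin f ne(2) M] by blast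
  have "real (card (V - B)) \<le> (1 - real (Suc j) / card C) * real (card (V - M))" by (rule B(3))
  \<comment> \<open>The inequality \<open>1 - x \<le> exp (- x)\<close> holds for all real
    \<open>x\<close>, so \<open>Suc j > card C\<close> requires no separate case.\<close>
  also have "\<dots> \<le> exp (- (real (Suc j) / card C)) * real (card (V - M))"
    using exp_ge_add_one_self[of "- (real (Suc j) / card C)"] by (intro mult_right_mono) auto
  also have "\<dots> \<le> exp (- (real (Suc j) / card C)) *
      (exp (- (real j * (real j + 1) / (2 * card C))) * card V)"
    using VM by (intro mult_left_mono) auto
  also have "\<dots> = exp (- (real (Suc j) / card C) - real j * (real j + 1) / (2 * card C)) * card V"
    by (simp add: exp_add[symmetric] mult.assoc[symmetric])
  also have "- (real (Suc j) / card C) - real j * (real j + 1) / (2 * card C)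
      = - (real (Suc j) * (real (Suc j) + 1) / (2 * card C))"
    using fin(2) ne(2) by (simp add: field_simps)
  finally show ?case using B(1,2) by blast
qed

text \<open>For \<open>k = 1\<close> only the empty set is deleted, so 1-connectedness is
  connectedness on at least two vertices.\<close>

lemma colour_connected_imp_max_order_ge:
  assumes A: "A \<subseteq> {1..n}" "colour_connected f s A" "2 \<le> card A"
  shows "card A \<le> max_order f n s 1"
proof -
  let ?S = "{card V | V E. subgraph_of_K n V E \<and> k_connected 1 V E \<and> num_colours f E \<le> s}"
  obtain E where E: "E \<subseteq> [A]\<^bsup>2\<^esup>" "connected_graph A E" "card (f ` E) \<le> s"
    using A(2) by (auto simp: colour_connected_def)
  have fin: "finite A" using A(1) by (meson finite_atLeastAtMost finite_subset)
  have "k_connected 1 A E"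
    unfolding k_connected_def
  proof (intro conjI allI impI)
    fix X assume X: "X \<subseteq> A \<and> card X < 1"
    \<comment> \<open>Finiteness matters here, since an infinite set also has \<open>card\<close>
      equal to 0.\<close>
    then have "X = {}" using fin finite_subset by fastforce
    then show "connected_graph (A - X) (delete_vertices_edges E X)"
      using E(2) by (simp add: delete_vertices_edges_def)
  qed (use fin A(3) in auto)
  then have mem: "card A \<in> ?S"
    using A(1) E by (auto simp: subgraph_of_K_def num_colours_def)
  have "?S \<subseteq> card ` Pow {1..n}" by (auto simp: subgraph_of_K_def)
  then have "finite ?S" by (rule finite_subset) simp
  then show ?thesis unfolding max_order_def using mem by (intro Max_ge) auto
qed

lemma max_order_lower_bound:
  assumes n: "n \<ge> 2" and r: "r \<ge> 1" and s: "s \<ge> 1" and f: "f \<in> colourings n r"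
  shows "(1 - exp (- (real s * (real s + 1) / (2 * real r)))) * real n \<le> max_order f n s 1"
proof -
  let ?V = "{1..n}"
  have f': "f \<in> [?V]\<^bsup>2\<^esup> \<rightarrow> {1..r}"
    using f by (auto simp: colourings_def K_edges_def PiE_def)
  obtain A where A: "A \<subseteq> ?V" "colour_connected f s A"
    "real (card (?V - A)) \<le> exp (- (real s * (real s + 1) / (2 * real r))) * real n"
    using colour_connected_large[OF _ _ f', of s] n r by auto
  obtain M where M: "M \<subseteq> ?V" "colour_connected f s M"
    "\<And>B. B \<subseteq> ?V \<Longrightarrow> colour_connected f s B \<Longrightarrow> card B \<le> card M"
    using max_colour_connected_exists[OF _ A(1,2)] by blast
  \<comment> \<open>\<open>A\<close> could be a single vertex. One edge uses one colour, so a
    largest set \<open>M\<close> has the two vertices that 1-connectedness demands.\<close>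
  have "colour_connected f s {1, 2::nat}"
    using s by (intro colour_connected_star) auto
  then have "card {1, 2::nat} \<le> card M" using n by (intro M(3)) auto
  then have "card M \<le> max_order f n s 1"
    using M(1,2) by (intro colour_connected_imp_max_order_ge) auto
  moreover have "card A \<le> card M" by (rule M(3)[OF A(1,2)])
  moreover have "real (card (?V - A)) = real n - real (card A)"
    using A(1) card_mono[OF _ A(1)] by (simp add: card_Diff_subset finite_subset of_nat_diff)
  ultimately show ?thesis using A(3) by (simp add: algebra_simps)
qed

theorem theorem5p2:
  fixes n r s :: nat
  assumes "n \<ge> 2" and "r \<ge> 1"
  shows "real (min_max_order n r s 1) \<ge> (1 - exp (- ((real s)\<^sup>2 / (3 * real r)))) * real n"
\<comment> \<open>For \<open>s = 0\<close> the claimed bound is 0; the edge used to obtain two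
  vertices requires a colour.\<close>
proof (cases "s = 0")
  case False
  let ?S = "(\<lambda>f. max_order f n s 1) ` colourings n r"
  \<comment> \<open>Finiteness and nonemptiness ensure that the minimum is attained by some
    colouring, to which the bound applies.\<close>
  have "finite (colourings n r)"
    unfolding colourings_def K_edges_def by (intro finite_PiE finite_imp_finite_nsets) auto
  moreover have "colourings n r \<noteq> {}"
    using assms(2) by (auto simp: colourings_def PiE_eq_empty_iff)
  ultimately have "min_max_order n r s 1 \<in> ?S"
    unfolding min_max_order_def by (intro Min_in) auto
  then obtain f where f: "f \<in> colourings n r" "min_max_order n r s 1 = max_order f n s 1" by blast
  have "(real s)\<^sup>2 / (3 * real r) \<le> real s * (real s + 1) / (2 * real r)"
    using assms(2) by (simp add: field_simps power2_eq_square)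
  then have "(1 - exp (- ((real s)\<^sup>2 / (3 * real r)))) * real n
      \<le> (1 - exp (- (real s * (real s + 1) / (2 * real r)))) * real n"
    by (intro mult_right_mono) auto
  also have "\<dots> \<le> max_order f n s 1"
    using max_order_lower_bound[OF assms _ f(1)] False by simp
  finally show ?thesis using f(2) by simp
qed simp

end
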